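(* The feasible region of the Multistage model is a subset of the feasible region of the Two-Stage model. Furthermore, the optimal value of the Multistage model is less than or equal to the optimal value of the Two-Stage model.
   Context: **Distribution system.** $T\ge 1$ is an integer, $S_T=\{1,\dots,T\}$, $\tau>0$. $S_N$ is a finite set of nodes containing node $1$; $S_D,S_G,S_S\subseteq S_N$ are the sets of loads, generators and energy storage systems (ESSs). For each period $t$ the variables are $p_t^A\in\mathbb{R}$ (aggregate power), $p_t^S=(p_{it}^S)_{i\in S_S}$, $e_t^S=(e_{it}^S)_{i\in S_S}$ (stored energy), and $y_t=(p_{it}^D,q_{it}^D,p_{it}^G,q_{it}^G,q_{it}^S,p_{it}^N,q_{it}^N)_{i\in S_N}$; quantities of a device type not present at node $i$ are $0$. Real data are given: $\underline P_{it}^D,\overline P_{it}^D,\eta_{it}^D,\underline P_{it}^G,\overline P_{it}^G,\overline S_{it}^G,\overline S_i^S,\underline E_i^S,\overline E_i^S$, with $\overline P_i^{SD},\overline P_i^{SC}>0$, $\kappa_i^S,\eta_i^{SD},\eta_i^{SC}\in(0,1]$, a convex set $C_N$, and a given initial stored energy $e_0^S=(e_{i0}^S)_{i\in S_S}$. **The set $C_t$.** $C_t$ is the set of $(p_t^A,p_t^S,y_t)$ with: $\underline P_{it}^D\le p_{it}^D\le\overline P_{it}^D$ and $q_{it}^D=\eta_{it}^Dp_{it}^D$ for $i\in S_D$; $\underline P_{it}^G\le p_{it}^G\le\overline P_{it}^G$ and $(p_{it}^G)^2+(q_{it}^G)^2\le(\overline S_{it}^G)^2$ for $i\in S_G$;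 $-\overline P_i^{SC}\le p_{it}^S\le\overline P_i^{SD}$ and $(p_{it}^S)^2+(q_{it}^S)^2\le(\overline S_i^S)^2$ for $i\in S_S$; $p_{it}^N=p_{it}^G+p_{it}^S-p_{it}^D$ and $q_{it}^N=q_{it}^G+q_{it}^S-q_{it}^D$ for $i\in S_N$; $p_t^A=p_{1t}^N$; $((p_{it}^N)_{i\in S_N},(q_{it}^N)_{i\in S_N})\in C_N$. It is assumed that $C_t$ is convex and closed. **Operational constraints.** $(\mathrm{OC}_t)$: $(p_t^A,p_t^S,y_t)\in C_t$; $e_{it}^S=\kappa_i^Se_{i(t-1)}^S-\max\{p_{it}^S,0\}\tau/\eta_i^{SD}-\min\{p_{it}^S,0\}\tau\eta_i^{SC}$ and $\underline E_i^S\le e_{it}^S\le\overline E_i^S$ for all $i\in S_S$. **Models.** $\phi:\mathbb{R}^T\times\mathbb{R}^T\to\mathbb{R}$ is a function; both models maximize $\phi(p^{A\vee},p^{A\wedge})$ over $(p^{A\vee},p^{A\wedge})\in\mathbb{R}^T\times\mathbb{R}^T$, and the optimal value is the supremum over the feasible set, in $[-\infty,\infty]$. *Two-Stage model:* feasibility means: for all $p^A\in\prod_{t\in S_T}[p_t^{A\vee},p_t^{A\wedge}]$ there exist $(e_t^S,p_t^S,y_t)_{t\in S_T}$ such that $(\mathrm{OC}_t)$ holds for all $t\in S_T$. *Multistage model:* feasibility means: $\forall p_1^A\in[p_1^{A\vee},p_1^{A\wedge}]\ \exists e_1^S,p_1^S,y_1\ \forall p_2^A\in[p_2^{A\vee},p_2^{A\wedge}]\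 \exists e_2^S,p_2^S,y_2\ \cdots\ \forall p_T^A\in[p_T^{A\vee},p_T^{A\wedge}]\ \exists e_T^S,p_T^S,y_T$ such that $(\mathrm{OC}_t)$ holds for all $t\in S_T$. *)

theory Defs
  imports "HOL-Analysis.Analysis"
begin

text \<open>
  The finite node set is (the universe of) the type \<open>'n\<close>. A family indexed by a set of devices
  (loads, generators, storage systems) is a vector over all nodes; entries of decision variables
  at nodes without such a device are forced to be 0, entries of data there are never used.
  Periods are the natural numbers \<open>1, \<dots>, horizon\<close>.
\<close>

record ('n::finite) system =
  horizon :: nat
  tau :: real
  node1 :: 'n
  loads :: "'n set"
  generators :: "'n set"
  storages :: "'n set"
  PD_lo :: "nat \<Rightarrow> real ^ 'n"
  PD_hi :: "nat \<Rightarrow> real ^ 'n"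
  etaD :: "nat \<Rightarrow> real ^ 'n"
  PG_lo :: "nat \<Rightarrow> real ^ 'n"
  PG_hi :: "nat \<Rightarrow> real ^ 'n"
  SG_hi :: "nat \<Rightarrow> real ^ 'n"
  SS_hi :: "real ^ 'n"
  ES_lo :: "real ^ 'n"
  ES_hi :: "real ^ 'n"
  PSD_hi :: "real ^ 'n"
  PSC_hi :: "real ^ 'n"
  kappaS :: "real ^ 'n"
  etaSD :: "real ^ 'n"
  etaSC :: "real ^ 'n"
  CN :: "((real ^ 'n) \<times> (real ^ 'n)) set"
  e0 :: "real ^ 'n"

definition periods :: "('n::finite) system \<Rightarrow> nat set" where
  "periods D = {1..horizon D}"

text \<open>The tuple \<open>(pD, qD, pG, qG, qS, pN, qN)\<close> of one period.\<close>

type_synonym 'n network_vars =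
  "(real ^ 'n) \<times> (real ^ 'n) \<times> (real ^ 'n) \<times> (real ^ 'n) \<times> (real ^ 'n) \<times> (real ^ 'n) \<times> (real ^ 'n)"

definition C :: "('n::finite) system \<Rightarrow> nat \<Rightarrow> (real \<times> (real ^ 'n) \<times> 'n network_vars) set" where
  "C D t = {(pA, pS, pD, qD, pG, qG, qS, pN, qN).
     (\<forall>i\<in>loads D. PD_lo D t $ i \<le> pD $ i \<and> pD $ i \<le> PD_hi D t $ i
        \<and> qD $ i = etaD D t $ i * pD $ i) \<and>
     (\<forall>i\<in>generators D. PG_lo D t $ i \<le> pG $ i \<and> pG $ i \<le> PG_hi D t $ i
        \<and> (pG $ i)\<^sup>2 + (qG $ i)\<^sup>2 \<le> (SG_hi D t $ i)\<^sup>2) \<and>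
     (\<forall>i\<in>storages D. - (PSC_hi D $ i) \<le> pS $ i \<and> pS $ i \<le> PSD_hi D $ i
        \<and> (pS $ i)\<^sup>2 + (qS $ i)\<^sup>2 \<le> (SS_hi D $ i)\<^sup>2) \<and>
     (\<forall>i. i \<notin> loads D \<longrightarrow> pD $ i = 0 \<and> qD $ i = 0) \<and>
     (\<forall>i. i \<notin> generators D \<longrightarrow> pG $ i = 0 \<and> qG $ i = 0) \<and>
     (\<forall>i. i \<notin> storages D \<longrightarrow> pS $ i = 0 \<and> qS $ i = 0) \<and>
     (\<forall>i. pN $ i = pG $ i + pS $ i - pD $ i) \<and>
     (\<forall>i. qN $ i = qG $ i + qS $ i - qD $ i) \<and>
     pA = pN $ node1 D \<and>
     (pN, qN) \<in> CN D}"

definition distribution_system :: "('n::finite) system \<Rightarrow> bool" where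
  "distribution_system D \<longleftrightarrow>
     horizon D \<ge> 1 \<and> tau D > 0 \<and>
     (\<forall>i\<in>storages D. PSD_hi D $ i > 0 \<and> PSC_hi D $ i > 0
        \<and> kappaS D $ i \<in> {0<..1} \<and> etaSD D $ i \<in> {0<..1} \<and> etaSC D $ i \<in> {0<..1}) \<and>
     convex (CN D) \<and>
     (\<forall>t\<in>periods D. convex (C D t) \<and> closed (C D t))"

definition OC :: "('n::finite) system \<Rightarrow> nat \<Rightarrow> real \<Rightarrow> real ^ 'n \<Rightarrow> real ^ 'n \<Rightarrow> real ^ 'n
    \<Rightarrow> 'n network_vars \<Rightarrow> bool" where
  "OC D t pA e_prev e pS y \<longleftrightarrow>
     (pA, pS, y) \<in> C D t \<and>
     (\<forall>i\<in>storages D.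
        e $ i = kappaS D $ i * e_prev $ i - max (pS $ i) 0 * tau D / etaSD D $ i
                - min (pS $ i) 0 * tau D * etaSC D $ i
        \<and> ES_lo D $ i \<le> e $ i \<and> e $ i \<le> ES_hi D $ i) \<and>
     (\<forall>i. i \<notin> storages D \<longrightarrow> e $ i = 0)"

text \<open>The recourse decisions \<open>(e, pS, y)\<close> of one period.\<close>

type_synonym 'n recourse = "(real ^ 'n) \<times> (real ^ 'n) \<times> 'n network_vars"

definition OC_all :: "('n::finite) system \<Rightarrow> (nat \<Rightarrow> real) \<Rightarrow> (nat \<Rightarrow> 'n recourse) \<Rightarrow> bool" where
  "OC_all D pA x \<longleftrightarrow> (\<forall>t\<in>periods D. case x t of (e, pS, y) \<Rightarrow>
     OC D t (pA t) (if t = 1 then e0 D else fst (x (t - 1))) e pS y)"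

text \<open>
  \<open>R^T\<close> consists of the functions that are \<open>undefined\<close> outside the periods, so that
  families are equal as soon as they agree on all periods.
\<close>

definition profiles :: "('n::finite) system \<Rightarrow> (nat \<Rightarrow> real) set" where
  "profiles D = periods D \<rightarrow>\<^sub>E UNIV"

definition two_stage_region :: "('n::finite) system \<Rightarrow> ((nat \<Rightarrow> real) \<times> (nat \<Rightarrow> real)) set" where
  "two_stage_region D = {(lo, hi) \<in> profiles D \<times> profiles D.
     \<forall>pA \<in> (\<Pi>\<^sub>E t\<in>periods D. {lo t..hi t}). \<exists>x. OC_all D pA x}"

text \<open>
  For distinct \<open>t1, \<dots>, tk\<close>, the proposition \<open>alternating [t1, \<dots>, tk] I P\<close> unfolds to
  \<open>\<forall>a1\<in>I t1. \<exists>x1. \<dots> \<forall>ak\<in>I tk. \<exists>xk. P p z\<close>, where \<open>p\<close> and \<open>z\<close> map each \<open>tj\<close> to \<open>aj\<close> and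
  \<open>xj\<close>, respectively, and everything else to \<open>undefined\<close>.
\<close>

primrec alternating ::
    "'t list \<Rightarrow> ('t \<Rightarrow> 'a set) \<Rightarrow> (('t \<Rightarrow> 'a) \<Rightarrow> ('t \<Rightarrow> 'x) \<Rightarrow> bool) \<Rightarrow> bool" where
  "alternating [] I P \<longleftrightarrow> P (\<lambda>_. undefined) (\<lambda>_. undefined)"
| "alternating (t # ts) I P \<longleftrightarrow>
     (\<forall>a\<in>I t. \<exists>x. alternating ts I (\<lambda>p z. P (p(t := a)) (z(t := x))))"

definition multistage_region :: "('n::finite) system \<Rightarrow> ((nat \<Rightarrow> real) \<times> (nat \<Rightarrow> real)) set" where
  "multistage_region D = {(lo, hi) \<in> profiles D \<times> profiles D.
     alternating [1..<Suc (horizon D)] (\<lambda>t. {lo t..hi t}) (OC_all D)}"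

definition optimal_value :: "((nat \<Rightarrow> real) \<Rightarrow> (nat \<Rightarrow> real) \<Rightarrow> real)
    \<Rightarrow> ((nat \<Rightarrow> real) \<times> (nat \<Rightarrow> real)) set \<Rightarrow> ereal" where
  "optimal_value \<phi> F = (SUP (lo, hi)\<in>F. ereal (\<phi> lo hi))"

end

theory Submission imports Defs begin

text \<open>Play a fixed aggregate profile against the nested quantifiers: each universal quantifier
  is instantiated with the entry of that period, and the witnesses collected along the way form one
  recourse for the whole profile (\<open>alternating_imp_ex\<close>). This gives the inclusion of
  regions, and a supremum can only grow with its set.\<close>

lemma alternating_imp_ex:
  assumes "distinct ts" "alternating ts I P" "p \<in> Pi\<^sub>E (set ts) I"
  shows "\<exists>z. P p z"
  using assms
\<comment> \<open>Peeling off one quantifier pair builds the chosen entry and witness into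
  \<open>P\<close> and shortens the domain of \<open>p\<close>, so both must vary.\<close>
proof (induction ts arbitrary: P p)
  case Nil
  then show ?case by auto
next
  case (Cons t ts)
  have "p t \<in> I t"
    using Cons.prems(3) by auto
  with Cons.prems(2) obtain x
    where x: "alternating ts I (\<lambda>q z. P (q(t := p t)) (z(t := x)))"
    by auto
  \<comment> \<open>Extensionality over \<open>set ts\<close> requires the entry at \<open>t\<close>
    to be erased, as \<open>t\<close> is not in \<open>ts\<close> by distinctness; the update inside
    the predicate restores it.\<close>
  have "p(t := undefined) \<in> Pi\<^sub>E (set ts) I"
    using Cons.prems(1,3) by (auto simp: PiE_iff extensional_def)
  from Cons.IH[OF _ x this] Cons.prems(1)
  obtain z where "P (p(t := undefined, t := p t)) (z(t := x))"
    by fastforce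
  then show ?case
    by (metis fun_upd_triv fun_upd_upd)
qed

lemma multistage_region_subset: "multistage_region D \<subseteq> two_stage_region D"
proof -
  \<comment> \<open>Thus the product over the list is the box of the two-stage model.\<close>
  have "set [1..<Suc (horizon D)] = periods D"
    by (auto simp: periods_def)
  then have "\<exists>x. OC_all D pA x"
    if "alternating [1..<Suc (horizon D)] I (OC_all D)" "pA \<in> Pi\<^sub>E (periods D) I" for I pA
    using alternating_imp_ex[OF distinct_upt that(1)] that(2) by metis
  then show ?thesis
    unfolding multistage_region_def two_stage_region_def by blast
qed

lemma optimal_value_mono: "F \<subseteq> G \<Longrightarrow> optimal_value \<phi> F \<le> optimal_value \<phi> G"
  unfolding optimal_value_def by (intro SUP_subset_mono) auto

theorem proposition1:
  fixes D :: "('n::finite) system" and \<phi> :: "(nat \<Rightarrow> real) \<Rightarrow> (nat \<Rightarrow> real) \<Rightarrow> real"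
  assumes "distribution_system D"
  shows "multistage_region D \<subseteq> two_stage_region D
    \<and> optimal_value \<phi> (multistage_region D) \<le> optimal_value \<phi> (two_stage_region D)"
  using multistage_region_subset optimal_value_mono by blast

end
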